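(* Let $S\subset\mathcal{X}$ be a nonempty exposed subset for the exponential family $p(x;\theta)=\exp\left(\sum_{j=1}^m\theta_jT_j(x)-\psi(\theta)\right)$, $\theta\in\mathbb{R}^m$. If a density $q$ belongs to the trace of the exponential family on $S$, then $q$ belongs to the extended exponential family, i.e. there is a sequence $\theta_n\in\mathbb{R}^m$ with $\lim_{n\to\infty}p(x;\theta_n)=q(x)$ for all $x\in\mathcal{X}$.
   Context: $\mathcal{X}$ is a finite nonempty set with a reference measure $\mu$ satisfying $\mu(x)>0$ for all $x\in\mathcal{X}$. A density is a function $q:\mathcal{X}\to[0,\infty)$ with $\sum_{x\in\mathcal{X}} q(x)\mu(x)=1$. Given functions $T_1,\dots,T_m:\mathcal{X}\to\mathbb{R}$ (canonical statistics), the exponential family is the set of densities $p(x;\theta)=\exp\left(\sum_{j=1}^m\theta_jT_j(x)-\psi(\theta)\right)$, $\theta\in\mathbb{R}^m$, where $\psi(\theta)=\log\sum_{x\in\mathcal{X}}\exp\left(\sum_j\theta_jT_j(x)\right)\mu(x)$. The extended exponential family is the closure of the exponential family, in the set of all densities, for pointwise convergence on $\mathcal{X}$. Let $T=(T_1,\dots,T_m):\mathcal{X}\to\mathbb{R}^m$. The marginal polytope $M$ is the convex hull of $T(\mathcal{X})$ in $\mathbb{R}^m$. A face of $M$ is a subset $F\subset M$ for which there is an affine map $A:\mathbb{R}^m\to\mathbb{R}$ that is zero on $F$ and strictly positive on $M\setminus F$. A subset $S\subset\mathcal{X}$ is exposed (for the exponential family) if $S=T^{-1}(F)$ for some face $F$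 of $M$. For a nonempty $S\subset\mathcal{X}$, the trace of the exponential family on $S$ is the exponential family on $(S,\mu_{|S})$ obtained by conditioning on $S$; a density $q$ on $\mathcal{X}$ belongs to the trace on $S$ if there is $\bar\theta\in\mathbb{R}^m$ with $q(x)=\exp\left(\sum_j\bar\theta_jT_j(x)\right)/\sum_{y\in S}\exp\left(\sum_j\bar\theta_jT_j(y)\right)\mu(y)$ for $x\in S$ and $q(x)=0$ for $x\in\mathcal{X}\setminus S$. *)

theory Defs
  imports "HOL-Analysis.Analysis"
begin

(* The finite nonempty sample space is the type 'x :: finite; the m canonical statistics are the
   components of T :: 'x => real^'m, and mu gives the weights of the reference measure. *)

definition densities :: "('x::finite \<Rightarrow> real) \<Rightarrow> ('x \<Rightarrow> real) set" where
  "densities \<mu> = {q. (\<forall>x. 0 \<le> q x) \<and> (\<Sum>x\<in>UNIV. q x * \<mu> x) = 1}"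

definition log_partition :: "('x::finite \<Rightarrow> real) \<Rightarrow> ('x \<Rightarrow> real^'m) \<Rightarrow> real^'m \<Rightarrow> real" where
  "log_partition \<mu> T \<theta> = ln (\<Sum>x\<in>UNIV. exp (\<Sum>j\<in>UNIV. \<theta> $ j * T x $ j) * \<mu> x)"

definition exp_density :: "('x::finite \<Rightarrow> real) \<Rightarrow> ('x \<Rightarrow> real^'m) \<Rightarrow> real^'m \<Rightarrow> 'x \<Rightarrow> real" where
  "exp_density \<mu> T \<theta> x = exp ((\<Sum>j\<in>UNIV. \<theta> $ j * T x $ j) - log_partition \<mu> T \<theta>)"

definition exp_family :: "('x::finite \<Rightarrow> real) \<Rightarrow> ('x \<Rightarrow> real^'m) \<Rightarrow> ('x \<Rightarrow> real) set" where
  "exp_family \<mu> T = range (exp_density \<mu> T)"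

(* The library topology on 'x => real is the product topology, i.e. that of pointwise convergence;
   the closure is taken in the subspace of all densities. *)
definition extended_exp_family :: "('x::finite \<Rightarrow> real) \<Rightarrow> ('x \<Rightarrow> real^'m) \<Rightarrow> ('x \<Rightarrow> real) set" where
  "extended_exp_family \<mu> T = top_of_set (densities \<mu>) closure_of exp_family \<mu> T"

definition marginal_polytope :: "('x::finite \<Rightarrow> real^'m) \<Rightarrow> (real^'m) set" where
  "marginal_polytope T = convex hull (range T)"

definition affine_map :: "(real^'m \<Rightarrow> real) \<Rightarrow> bool" where
  "affine_map A \<longleftrightarrow> (\<exists>L b. linear L \<and> A = (\<lambda>t. L t + b))"

(* A face in this sense is what the library calls an exposed face; in contrast to face_of, the
   existence of a supporting affine map is part of the definition. The empty set and the whole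
   polytope qualify (A = 1 and A = 0). *)
definition is_polytope_face :: "(real^'m) set \<Rightarrow> (real^'m) set \<Rightarrow> bool" where
  "is_polytope_face F M \<longleftrightarrow>
     F \<subseteq> M \<and> (\<exists>A. affine_map A \<and> (\<forall>t\<in>F. A t = 0) \<and> (\<forall>t\<in>M - F. 0 < A t))"

definition exposed_subset :: "('x::finite \<Rightarrow> real^'m) \<Rightarrow> 'x set \<Rightarrow> bool" where
  "exposed_subset T S \<longleftrightarrow> (\<exists>F. is_polytope_face F (marginal_polytope T) \<and> S = T -` F)"

definition trace_exp_family ::
  "('x::finite \<Rightarrow> real) \<Rightarrow> ('x \<Rightarrow> real^'m) \<Rightarrow> 'x set \<Rightarrow> ('x \<Rightarrow> real) set" where
  "trace_exp_family \<mu> T S =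
     {q \<in> densities \<mu>. \<exists>\<theta>.
        (\<forall>x\<in>S. q x = exp (\<Sum>j\<in>UNIV. \<theta> $ j * T x $ j) /
                     (\<Sum>y\<in>S. exp (\<Sum>j\<in>UNIV. \<theta> $ j * T y $ j) * \<mu> y)) \<and>
        (\<forall>x\<in>-S. q x = 0)}"

end

theory Submission
  imports Defs
begin

text \<open>
  The supporting affine map of the face defines a direction in parameter space along which the
  family converges to its conditioning on the face. Write the map as \<open>t \<mapsto> a \<bullet> t + b\<close>, so that on
  the sample points it vanishes on \<open>S\<close> and is positive off \<open>S\<close>. Moving the parameter from
  \<open>\<theta>\<close> to \<open>\<theta> - n a\<close> multiplies the unnormalized density by
  \<open>exp (- (a \<bullet> T x + b)) ^ n\<close>, up to a factor that does not depend on \<open>x\<close> and is absorbed by the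
  normalization (\<open>exp_density_tilted\<close>). This factor is constantly \<open>1\<close> on \<open>S\<close> and decays
  geometrically off \<open>S\<close>. Since the sample space is finite, the normalizing sum converges term by
  term to the sum over \<open>S\<close>, which is positive because \<open>S\<close> is nonempty; hence the densities
  themselves converge to the trace density with parameter \<open>\<theta>\<close>.

  Pointwise convergence is convergence in the product topology, and \<open>q\<close> and all members of the
  family are densities, so the limit \<open>q\<close> lies in the closure relative to the densities.
\<close>

lemma sum_mult_eq_inner:
  fixes u v :: "real^'m"
  shows "(\<Sum>j\<in>UNIV. u $ j * v $ j) = u \<bullet> v"
  by (simp add: inner_vec_def)

lemma partition_sum_pos:
  fixes \<mu> :: "'x::finite \<Rightarrow> real"
  assumes "\<And>x. 0 < \<mu> x"
  shows "0 < (\<Sum>x\<in>UNIV. exp (f x) * \<mu> x)"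
  using assms by (intro sum_pos) auto

lemma exp_density_eq_quotient:
  fixes \<mu> :: "'x::finite \<Rightarrow> real"
  assumes "\<And>x. 0 < \<mu> x"
  shows "exp_density \<mu> T \<theta> x = exp (\<theta> \<bullet> T x) / (\<Sum>y\<in>UNIV. exp (\<theta> \<bullet> T y) * \<mu> y)"
  using partition_sum_pos[where \<mu> = \<mu> and f = "\<lambda>y. \<theta> \<bullet> T y", OF assms]
  by (simp add: exp_density_def log_partition_def sum_mult_eq_inner exp_diff)

lemma exp_density_in_densities:
  fixes \<mu> :: "'x::finite \<Rightarrow> real"
  assumes "\<And>x. 0 < \<mu> x"
  shows "exp_density \<mu> T \<theta> \<in> densities \<mu>"
  using partition_sum_pos[where \<mu> = \<mu> and f = "\<lambda>y. \<theta> \<bullet> T y", OF assms]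
  by (simp add: densities_def exp_density_eq_quotient[OF assms] less_imp_le
      flip: sum_divide_distrib)

lemma affine_map_iff_inner:
  fixes A :: "real^'m \<Rightarrow> real"
  shows "affine_map A \<longleftrightarrow> (\<exists>a b. \<forall>t. A t = a \<bullet> t + b)"
proof
  assume "affine_map A"
  then obtain L b where L: "linear L" and A: "A = (\<lambda>t. L t + b)"
    unfolding affine_map_def by blast
  have "L t = adjoint L 1 \<bullet> t" for t
    using adjoint_works[OF L, of t 1] by (simp add: inner_commute)
  then show "\<exists>a b. \<forall>t. A t = a \<bullet> t + b"
    unfolding A by auto
next
  assume "\<exists>a b. \<forall>t. A t = a \<bullet> t + b"
  then obtain a b where "A = (\<lambda>t. a \<bullet> t + b)" by blast
  then show "affine_map A"
    unfolding affine_map_def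
    by (metis bounded_linear_inner_right bounded_linear.linear)
qed

text \<open>
  Every \<open>T x\<close> lies in the marginal polytope, so membership of \<open>x\<close> in the exposed set and the
  sign of the supporting map at \<open>T x\<close> determine each other.
\<close>

lemma exposed_subset_supporting_direction:
  assumes "exposed_subset T S"
  obtains a b where "\<And>x. x \<in> S \<Longrightarrow> a \<bullet> T x + b = 0" "\<And>x. x \<notin> S \<Longrightarrow> 0 < a \<bullet> T x + b"
proof -
  obtain F A where A: "affine_map A" "\<forall>t\<in>F. A t = 0" "\<forall>t\<in>marginal_polytope T - F. 0 < A t"
    and S: "S = T -` F"
    using assms unfolding exposed_subset_def is_polytope_face_def by blast
  have "T x \<in> marginal_polytope T" for x
    unfolding marginal_polytope_def by (simp add: hull_inc)
  with A S show thesis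
    unfolding affine_map_iff_inner by (metis DiffI that vimage_eq)
qed

text \<open>
  The offset \<open>b\<close> contributes the same factor \<open>exp (- b) ^ n\<close> to the numerator and to the
  normalizing sum; inserting it makes the weights exactly \<open>1\<close> where \<open>a \<bullet> T x + b = 0\<close>.
\<close>

lemma exp_density_tilted:
  fixes \<mu> :: "'x::finite \<Rightarrow> real"
  assumes "\<And>x. 0 < \<mu> x"
  shows "exp_density \<mu> T (\<theta> - real n *\<^sub>R a) x =
    exp (\<theta> \<bullet> T x) * exp (- (a \<bullet> T x + b)) ^ n /
    (\<Sum>y\<in>UNIV. exp (\<theta> \<bullet> T y) * exp (- (a \<bullet> T y + b)) ^ n * \<mu> y)"
proof -
  have tilt: "exp (\<theta> \<bullet> T y) * exp (- (a \<bullet> T y + b)) ^ n =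
      exp (- (real n * b)) * exp ((\<theta> - real n *\<^sub>R a) \<bullet> T y)" for y
    by (simp add: inner_diff_left algebra_simps flip: exp_of_nat_mult exp_add)
  show ?thesis
    unfolding exp_density_eq_quotient[OF assms] tilt mult.assoc sum_distrib_left[symmetric]
    by simp
qed

lemma exp_density_tilted_tendsto:
  fixes \<mu> :: "'x::finite \<Rightarrow> real"
  assumes \<mu>: "\<And>x. 0 < \<mu> x"
    and "S \<noteq> {}"
    and on_S: "\<And>x. x \<in> S \<Longrightarrow> a \<bullet> T x + b = 0"
    and off_S: "\<And>x. x \<notin> S \<Longrightarrow> 0 < a \<bullet> T x + b"
  shows "(\<lambda>n. exp_density \<mu> T (\<theta> - real n *\<^sub>R a) x) \<longlonglongrightarrow>
    (if x \<in> S then exp (\<theta> \<bullet> T x) / (\<Sum>y\<in>S. exp (\<theta> \<bullet> T y) * \<mu> y) else 0)"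
proof -
  have weight: "(\<lambda>n. exp (- (a \<bullet> T y + b)) ^ n) \<longlonglongrightarrow> indicat_real S y" for y
    using on_S[of y] off_S[of y] by (cases "y \<in> S") (simp_all add: LIMSEQ_realpow_zero)
  have S_sum: "(\<Sum>y\<in>UNIV. exp (\<theta> \<bullet> T y) * indicator S y * \<mu> y) = (\<Sum>y\<in>S. exp (\<theta> \<bullet> T y) * \<mu> y)"
    by (rule sum.mono_neutral_cong_right) auto
  have "0 < (\<Sum>y\<in>S. exp (\<theta> \<bullet> T y) * \<mu> y)"
    using \<mu> \<open>S \<noteq> {}\<close> by (intro sum_pos) auto
  then have "(\<lambda>n. exp_density \<mu> T (\<theta> - real n *\<^sub>R a) x) \<longlonglongrightarrow>
      exp (\<theta> \<bullet> T x) * indicator S x / (\<Sum>y\<in>UNIV. exp (\<theta> \<bullet> T y) * indicator S y * \<mu> y)"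
    unfolding exp_density_tilted[OF \<mu>, where b = b]
    by (intro tendsto_intros weight) (simp add: S_sum)
  then show ?thesis
    by (cases "x \<in> S") (simp_all add: S_sum)
qed

lemma pointwise_limit_in_extended_exp_family:
  fixes \<mu> :: "'x::finite \<Rightarrow> real"
  assumes \<mu>: "\<And>x. 0 < \<mu> x"
    and q: "q \<in> densities \<mu>"
    and lim: "\<And>x. (\<lambda>n::nat. exp_density \<mu> T (\<theta> n) x) \<longlonglongrightarrow> q x"
  shows "q \<in> extended_exp_family \<mu> T"
proof -
  have "(\<lambda>n. exp_density \<mu> T (\<theta> n)) \<longlonglongrightarrow> q"
    using lim limitin_componentwise[of "\<lambda>_. euclideanreal" UNIV "\<lambda>n. exp_density \<mu> T (\<theta> n)" q]
    by (simp add: euclidean_product_topology)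
  then have "q \<in> closure (exp_family \<mu> T)"
    by (rule Lim_in_closed_set[rotated 3])
      (auto simp: exp_family_def intro!: always_eventually closure_subset[THEN subsetD])
  moreover have "exp_family \<mu> T \<subseteq> densities \<mu>"
    using exp_density_in_densities[OF \<mu>] unfolding exp_family_def by auto
  ultimately show ?thesis
    using q unfolding extended_exp_family_def by (simp add: closure_of_subtopology Int_absorb1)
qed

theorem theorem2:
  fixes \<mu> :: "'x::finite \<Rightarrow> real"
    and T :: "'x \<Rightarrow> real^'m"
    and S :: "'x set"
    and q :: "'x \<Rightarrow> real"
  assumes "\<And>x. 0 < \<mu> x"
    and "S \<noteq> {}"
    and "exposed_subset T S"
    and "q \<in> trace_exp_family \<mu> T S"
  shows "q \<in> extended_exp_family \<mu> T \<and>
    (\<exists>\<theta>::nat \<Rightarrow> real^'m. \<forall>x. (\<lambda>n. exp_density \<mu> T (\<theta> n) x) \<longlonglongrightarrow> q x)"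
proof -
  obtain a b where ab: "\<And>x. x \<in> S \<Longrightarrow> a \<bullet> T x + b = 0" "\<And>x. x \<notin> S \<Longrightarrow> 0 < a \<bullet> T x + b"
    using exposed_subset_supporting_direction[OF assms(3)] by blast
  obtain \<theta> where q: "q \<in> densities \<mu>"
    "\<And>x. q x = (if x \<in> S then exp (\<theta> \<bullet> T x) / (\<Sum>y\<in>S. exp (\<theta> \<bullet> T y) * \<mu> y) else 0)"
    using assms(4) unfolding trace_exp_family_def sum_mult_eq_inner by force
  have lim: "(\<lambda>n. exp_density \<mu> T (\<theta> - real n *\<^sub>R a) x) \<longlonglongrightarrow> q x" for x
    using exp_density_tilted_tendsto[where \<theta> = \<theta> and x = x, OF assms(1,2) ab] unfolding q(2) .
  show ?thesis
    using pointwise_limit_in_extended_exp_family[OF assms(1) q(1) lim] lim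
    by (intro conjI exI[of _ "\<lambda>n. \<theta> - real n *\<^sub>R a"] allI)
qed

end
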